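(* Let $H_n$ be the Hermite polynomials and let $\mathrm{Ai}$ be the Airy function. As $n\to\infty$: (i) For $\xi\approx-\sqrt{2n}$, $$H_n(\xi)\sim\Lambda_3(\xi)\equiv(-1)^n\sqrt{2\pi}\,n^{1/6}\exp\left[\frac n2\ln(2n)-\frac32n-\xi\sqrt{2n}\right]\mathrm{Ai}\left[-n^{1/6}\sqrt2\left(\xi+\sqrt{2n}\right)\right].$$ (ii) For $\xi\approx\sqrt{2n}$, $$H_n(\xi)\sim\Lambda_4(\xi)\equiv\sqrt{2\pi}\,n^{1/6}\exp\left[\frac n2\ln(2n)-\frac32n+\xi\sqrt{2n}\right]\mathrm{Ai}\left[n^{1/6}\sqrt2\left(\xi-\sqrt{2n}\right)\right].$$ Moreover, $\Lambda_3(-\xi)=(-1)^n\Lambda_4(\xi)$.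
   Context: The Hermite polynomials are $H_n(x)=n!\sum_{k=0}^{\lfloor n/2\rfloor}\frac{(-1)^k}{k!(n-2k)!}(2x)^{n-2k}$, $n=0,1,2,\ldots$.
   Formalization: ξ≈±√(2n) is read as ξ∓√(2n)=O(n^{-1/6}); since the ratio form of ∼ fails at zeros of Ai (there Λ=0 but H_n≠0), it is claimed where the Airy factor stays away from 0, and otherwise H_n−Λ is o of Λ's non-Airy factor. *)

theory Defs
  imports "HOL-Analysis.Analysis" "HOL-Library.Landau_Symbols"
begin

definition hermite :: "nat \<Rightarrow> real \<Rightarrow> real" where
  "hermite n x =
     fact n * (\<Sum>k\<le>n div 2. (-1) ^ k / (fact k * fact (n - 2 * k)) * (2 * x) ^ (n - 2 * k))"

text \<open>
  The integral is only conditionally convergent. The Henstock--Kurzweil integral over the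
  unbounded set \<open>{0..}\<close> is the limit of the integrals over \<open>{0..T}\<close> as \<open>T\<close> tends to infinity,
  so this is the classical improper integral for the Airy function on the real line.
\<close>
definition Ai :: "real \<Rightarrow> real" where
  "Ai x = integral {0..} (\<lambda>s. cos (s ^ 3 / 3 + x * s)) / pi"

definition Lambda3 :: "nat \<Rightarrow> real \<Rightarrow> real" where
  "Lambda3 n \<xi> = (-1) ^ n * sqrt (2 * pi) * real n powr (1/6)
     * exp (real n / 2 * ln (2 * real n) - 3/2 * real n - \<xi> * sqrt (2 * real n))
     * Ai (- (real n powr (1/6) * sqrt 2 * (\<xi> + sqrt (2 * real n))))"

definition Lambda4 :: "nat \<Rightarrow> real \<Rightarrow> real" where
  "Lambda4 n \<xi> = sqrt (2 * pi) * real n powr (1/6)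
     * exp (real n / 2 * ln (2 * real n) - 3/2 * real n + \<xi> * sqrt (2 * real n))
     * Ai (real n powr (1/6) * sqrt 2 * (\<xi> - sqrt (2 * real n)))"

text \<open>
  The non-oscillating factor: up to sign, \<open>Lambda4 n \<xi>\<close> and \<open>Lambda3 n \<xi>\<close> are the Airy value
  times \<open>amplitude n \<xi>\<close> and \<open>amplitude n (- \<xi>)\<close> respectively.
  It is the scale on which errors are measured where the Airy factor may vanish.
\<close>
definition amplitude :: "nat \<Rightarrow> real \<Rightarrow> real" where
  "amplitude n y = sqrt (2 * pi) * real n powr (1/6)
     * exp (real n / 2 * ln (2 * real n) - 3/2 * real n + y * sqrt (2 * real n))"

text \<open>
  \<open>\<xi> \<approx> c\<close> for sequences: \<open>\<xi>\<close> stays in the turning-point layer of width \<open>n powr (-1/6)\<close>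
  around \<open>c\<close>, i.e. the Airy variable \<open>n powr (1/6) * sqrt 2 * (\<xi> n - c n)\<close> is bounded.
\<close>
definition in_layer :: "(nat \<Rightarrow> real) \<Rightarrow> (nat \<Rightarrow> real) \<Rightarrow> bool" where
  "in_layer \<xi> c \<longleftrightarrow> (\<lambda>n. \<xi> n - c n) \<in> O(\<lambda>n. real n powr (-1/6))"

text \<open>
  Asymptotic equivalence \<open>f \<sim> g\<close> cannot hold literally along sequences on which the Airy factor
  of \<open>g\<close> vanishes, so it is required wherever that factor is bounded away from zero.
\<close>
definition away_from_zero :: "(nat \<Rightarrow> real) \<Rightarrow> bool" where
  "away_from_zero a \<longleftrightarrow> (\<exists>\<delta>>0. \<forall>\<^sub>F n in sequentially. \<delta> \<le> \<bar>a n\<bar>)"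

end

theory Submission
  imports Defs "HOL-Complex_Analysis.Complex_Analysis" "HOL-Real_Asymp.Real_Asymp"
begin

text \<open>
  By Cauchy's formula for the generating function \<open>exp (2 x z - z\<^sup>2)\<close> on the circle through the double
  saddle point \<open>z = sqrt (n / 2)\<close>, the Hermite polynomial is an integral over \<open>\<theta> \<in> [0, \<pi>]\<close>.
  For \<open>\<theta> = s / n powr (1/3)\<close> its phase tends to the Airy phase \<open>s ^ 3 / 3 + t s\<close> and its modulus
  to a constant, uniformly for \<open>s \<le> S\<close>. No absolutely integrable majorant exists, so the part
  \<open>s \<ge> S\<close> is bounded by \<open>O (1 / S\<^sup>2)\<close> with the second mean value theorem: there the modulus decreases
  and the phase derivative increases. The same argument bounds the tail of the Airy integral.
  Stirling's formula, derived from Wallis' product, turns the prefactor into the stated amplitude.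
\<close>

section \<open>Stirling's formula\<close>

text \<open>Increments of order \<open>1 / n ^ 2\<close> are summable, so the sequence converges as
  a telescoping series. This gives no value for the limit; Wallis' product supplies it in
  \<open>stirling\<close>.\<close>

lemma stirling_limit_exists:
  "\<exists>l. (\<lambda>n. ln (fact n) - (n + 1/2) * ln n + real n) \<longlonglongrightarrow> l"
proof -
  define b :: "nat \<Rightarrow> real" where "b n = ln (fact n) - (n + 1/2) * ln n + real n" for n
  have "(\<lambda>n. b (Suc n) - b n) \<in> O(\<lambda>n. 1 / real n ^ 2)"
  proof (subst landau_o.big.in_cong)
    show "\<forall>\<^sub>F n in sequentially. b (Suc n) - b n = 1 - (n + 1/2) * (ln (real n + 1) - ln n)"
      using eventually_gt_at_top[of 0]
    proof eventually_elim
      case (elim n)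
      have "ln (fact (Suc n) :: real) = ln (real n + 1) + ln (fact n)"
        by (simp add: ln_mult add.commute)
      then show ?case
        using elim by (simp add: b_def algebra_simps del: fact_Suc)
    qed
    \<comment> \<open>The shift 1/2 cancels the term of order \<open>1 / n\<close> in the expansion
      of \<open>ln (1 + 1 / n)\<close>; what remains is about
      \<open>- 1 / (12 * n ^ 2)\<close>.\<close>
    show "(\<lambda>n. 1 - (real n + 1/2) * (ln (real n + 1) - ln n)) \<in> O(\<lambda>n. 1 / real n ^ 2)"
      by real_asymp
  qed
  moreover have "summable (\<lambda>n. norm (1 / real n ^ 2))"
    using inverse_power_summable[of 2, where 'a=real] by (simp add: field_simps)
  ultimately have "summable (\<lambda>n. b (Suc n) - b n)"
    by (rule summable_comparison_test_bigo[rotated])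
  then have "(\<lambda>n. \<Sum>k<n. b (Suc k) - b k) \<longlonglongrightarrow> (\<Sum>k. b (Suc k) - b k)"
    by (rule summable_LIMSEQ)
  then have "(\<lambda>n. b n - b 0) \<longlonglongrightarrow> (\<Sum>k. b (Suc k) - b k)"
    by (simp only: sum_lessThan_telescope)
  \<comment> \<open>\<open>b 0\<close> involves the default value \<open>ln 0\<close>; it is only
    subtracted and added back, so its value does not matter.\<close>
  from tendsto_add[OF this tendsto_const[of "b 0"]]
  have "b \<longlonglongrightarrow> (\<Sum>k. b (Suc k) - b k) + b 0" by simp
  then show ?thesis unfolding b_def by blast
qed

text \<open>Factoring \<open>4 * k ^ 2 - 1\<close> as \<open>(2 * k - 1) * (2 * k + 1)\<close> turns
  the denominators into products of odd numbers, hence into factorials. The closed form can then be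
  compared with the ratio \<open>a n ^ 2 / a (2 * n)\<close> in \<open>stirling\<close>.\<close>

lemma wallis_product:
  "(\<Prod>k=1..n. (4 * real k ^ 2) / (4 * real k ^ 2 - 1))
     = (4 ^ n * fact n ^ 2 / fact (2 * n)) ^ 2 / (2 * real n + 1)"
proof (induction n)
  case (Suc n)
  have nz: "4 * (real n + 1) ^ 2 - 1 = (2 * real n + 1) * (2 * real n + 3)"
    by (simp add: power2_eq_square algebra_simps)
  have f: "(fact (2 * Suc n) :: real) = 2 * (real n + 1) * (2 * real n + 1) * fact (2 * n)"
    by (simp add: algebra_simps)
  have g: "(fact (Suc n) :: real) = (real n + 1) * fact n" by simp
  have "(\<Prod>k=1..Suc n. (4 * real k ^ 2) / (4 * real k ^ 2 - 1))
     = (4 ^ n * fact n ^ 2 / fact (2 * n)) ^ 2 / (2 * real n + 1)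
         * (4 * (real n + 1) ^ 2 / (4 * (real n + 1) ^ 2 - 1))"
    using Suc by (simp add: add.commute)
  also have "\<dots> = (4 ^ Suc n * fact (Suc n) ^ 2 / fact (2 * Suc n)) ^ 2 / (2 * real (Suc n) + 1)"
    unfolding nz f g
    by (simp add: divide_simps del: fact_Suc) (simp add: power2_eq_square power4_eq_xxxx algebra_simps)
  finally show ?case .
qed simp

text \<open>If \<open>a n\<close> tends to L, nonzero because it is an exponential, then
  \<open>a n ^ 2 / a (2 * n)\<close> also tends to L. Its square times a factor tending to 1/4 is
  Wallis' product, whose limit \<open>pi / 2\<close> forces \<open>L ^ 2 = 2 * pi\<close>.\<close>

lemma stirling:
  "(\<lambda>n. fact n / (sqrt (2 * pi * n) * (n / exp 1) ^ n) :: real) \<longlonglongrightarrow> 1"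
proof -
  obtain l where l: "(\<lambda>n. ln (fact n) - (n + 1/2) * ln n + real n) \<longlonglongrightarrow> l"
    using stirling_limit_exists by blast
  define a :: "nat \<Rightarrow> real" where "a n = fact n / (sqrt n * (n / exp 1) ^ n)" for n
  have a_eq: "exp (ln (fact n) - (n + 1/2) * ln n + real n) = a n" if "n > 0" for n
  proof -
    have "exp (ln (real n) * real n) = real n ^ n"
      using that by (metis exp_ln exp_of_nat2_mult of_nat_0_less_iff)
    moreover have "exp (ln (real n) * (1/2)) = sqrt n"
      using that by (simp add: powr_half_sqrt[symmetric] powr_def)
    moreover have "exp (real n) = exp 1 ^ n"
      by (metis exp_of_nat_mult mult.right_neutral)
    ultimately show ?thesis
      by (simp add: a_def exp_add exp_diff algebra_simps power_divide)
  qed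
  have a: "a \<longlonglongrightarrow> exp l"
    using tendsto_exp[OF l]
    by (rule Lim_transform_eventually)
      (use a_eq in \<open>auto intro: eventually_mono[OF eventually_gt_at_top[of 0]]\<close>)
  have a2: "(\<lambda>n. a (2 * n)) \<longlonglongrightarrow> exp l"
    using LIMSEQ_subseq_LIMSEQ[OF a, of "\<lambda>n. 2 * n"] by (simp add: strict_mono_def o_def)
  have "(\<lambda>n. n / (2 * (2 * real n + 1))) \<longlonglongrightarrow> 1/4"
    by real_asymp
  moreover have "(\<lambda>n. (a n ^ 2 / a (2 * n)) ^ 2) \<longlonglongrightarrow> (exp l ^ 2 / exp l) ^ 2"
    by (intro tendsto_power tendsto_divide a a2) simp
  ultimately have "(\<lambda>n. (a n ^ 2 / a (2 * n)) ^ 2 * (n / (2 * (2 * real n + 1))))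
          \<longlonglongrightarrow> (exp l ^ 2 / exp l) ^ 2 * (1/4)"
    by (intro tendsto_mult)
  moreover have "\<forall>\<^sub>F n in sequentially. (a n ^ 2 / a (2 * n)) ^ 2 * (n / (2 * (2 * real n + 1)))
     = (\<Prod>k=1..n. (4 * real k ^ 2) / (4 * real k ^ 2 - 1))"
    using eventually_gt_at_top[of 0]
  proof eventually_elim
    case (elim n)
    have "a n ^ 2 / a (2 * n) = sqrt (2 / n) * (4 ^ n * fact n ^ 2 / fact (2 * n))"
      using elim
      by (simp add: a_def real_sqrt_mult real_sqrt_divide divide_simps power_mult_distrib power_mult)
        (simp add: power2_eq_square power_mult_distrib algebra_simps)
    then have "(a n ^ 2 / a (2 * n)) ^ 2 = 2 / n * (4 ^ n * fact n ^ 2 / fact (2 * n)) ^ 2"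
      by (simp add: power_mult_distrib power_divide)
    moreover have "2 / n * q * (n / (2 * (2 * real n + 1))) = q / (2 * real n + 1)" for q
      using elim by (simp add: field_simps)
    ultimately show ?case
      by (simp only: wallis_product)
  qed
  ultimately have "(\<lambda>n. \<Prod>k=1..n. (4 * real k ^ 2) / (4 * real k ^ 2 - 1))
      \<longlonglongrightarrow> (exp l ^ 2 / exp l) ^ 2 * (1/4)"
    by (rule Lim_transform_eventually)
  from LIMSEQ_unique[OF this wallis] have "(exp l) ^ 2 = 2 * pi"
    by (simp add: power2_eq_square)
  then have "exp l = sqrt (2 * pi)"
    by (metis exp_ge_zero real_sqrt_unique)
  with a have "(\<lambda>n. a n / sqrt (2 * pi)) \<longlonglongrightarrow> sqrt (2 * pi) / sqrt (2 * pi)"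
    by (intro tendsto_intros) auto
  then show ?thesis
    by (simp add: a_def real_sqrt_mult mult_ac)
qed

section \<open>Hermite polynomials as contour integrals\<close>

text \<open>All exponents \<open>n - 2 * k\<close> have the parity of \<open>n\<close>. This
  symmetry carries the asymptotics from the right turning point to the left one.\<close>

lemma hermite_minus: "hermite n (- x) = (-1) ^ n * hermite n x"
proof -
  have "(2 * - x) ^ (n - 2 * k) = (-1) ^ n * (2 * x) ^ (n - 2 * k)" if "k \<le> n div 2" for k
  proof -
    have "even n \<longleftrightarrow> even (n - 2 * k)" using that by auto
    then have "(- 1 :: real) ^ (n - 2 * k) = (- 1) ^ n"
      by (cases "even n") simp_all
    moreover have "(2 * - x) ^ (n - 2 * k) = (- 1) ^ (n - 2 * k) * (2 * x) ^ (n - 2 * k)"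
      using power_minus[of "2 * x" "n - 2 * k"] by simp
    ultimately show ?thesis by simp
  qed
  then show ?thesis
    unfolding hermite_def by (simp add: sum_distrib_left mult_ac)
qed

text \<open>The derivatives at 0 are read off the formal power series: the Cauchy product of the
  series of \<open>exp (2 * x * z)\<close> and \<open>exp (- z ^ 2)\<close> is the defining
  sum.\<close>

lemma higher_deriv_hermite_generating_function:
  fixes x :: real
  shows "(deriv ^^ n) (\<lambda>z. exp (2 * of_real x * z - z ^ 2)) 0 = complex_of_real (hermite n x)"
proof -
  define F :: "complex fps" where "F = fps_exp (2 * of_real x)"
  define G :: "complex fps" where "G = fps_exp (-1) oo fps_X ^ 2"
  have "((\<lambda>z. exp (- 1 * z)) \<circ> (\<lambda>z. z ^ 2)) has_fps_expansion G"
    unfolding G_def by (intro fps_expansion_intros) simp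
  moreover have "(\<lambda>z. exp (2 * of_real x * z)) has_fps_expansion F"
    unfolding F_def by (intro fps_expansion_intros)
  ultimately have "(\<lambda>z. exp (2 * of_real x * z) * ((\<lambda>z. exp (- 1 * z)) \<circ> (\<lambda>z. z ^ 2)) z)
      has_fps_expansion (F * G)"
    by (rule has_fps_expansion_mult[rotated])
  then have "(\<lambda>z. exp (2 * of_real x * z - z ^ 2)) has_fps_expansion (F * G)"
    by (simp add: exp_diff exp_minus field_simps)
  then have "(deriv ^^ n) (\<lambda>z. exp (2 * of_real x * z - z ^ 2)) 0 = fact n * fps_nth (F * G) n"
    by (simp add: fps_nth_fps_expansion)
  also have "fps_nth (F * G) n = (\<Sum>i\<le>n. fps_nth G i * fps_nth F (n - i))"
    by (subst mult.commute) (simp add: fps_mult_nth atLeast0AtMost)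
  \<comment> \<open>\<open>G\<close> is a series in \<open>z ^ 2\<close>, so only even indices
    contribute.\<close>
  also have "\<dots> = (\<Sum>i\<in>(\<lambda>k. 2 * k) ` {..n div 2}. fps_nth G i * fps_nth F (n - i))"
    by (rule sum.mono_neutral_right) (auto simp: G_def fps_nth_compose_X_power elim!: dvdE)
  also have "\<dots> = (\<Sum>k\<le>n div 2. fps_nth G (2 * k) * fps_nth F (n - 2 * k))"
    by (subst sum.reindex) (auto simp: inj_on_def)
  also have "\<dots> = of_real (\<Sum>k\<le>n div 2. (-1) ^ k / (fact k * fact (n - 2 * k)) * (2 * x) ^ (n - 2 * k))"
    by (simp add: F_def G_def fps_nth_compose_X_power)
  finally show ?thesis by (simp add: hermite_def)
qed

text \<open>Reflection followed by a shift by \<open>2 * pi\<close> carries the first half of the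
  period onto the second, so both contribute equally.\<close>

lemma has_integral_0_2pi_symmetric:
  fixes f :: "real \<Rightarrow> real"
  assumes f: "(f has_integral I) {0..2 * pi}" and sym: "\<And>x. f (2 * pi - x) = f x"
  shows "(f has_integral I / 2) {0..pi}"
proof -
  obtain J where J: "(f has_integral J) {0..pi}"
    using integrable_subinterval_real[of f 0 "2 * pi" 0 pi] f by (auto simp: integrable_on_def)
  have "((\<lambda>x. f (- x)) has_integral J) {- pi..- 0}"
    using J by (simp only: has_integral_reflect_real)
  from has_integral_shift_real_ivl[OF this, of "- (2 * pi)"]
  have "(f has_integral J) {pi..2 * pi}"
    using sym by simp
  from has_integral_combine[OF _ _ J this] have "(f has_integral (J + J)) {0..2 * pi}"
    by simp
  from has_integral_unique[OF this f] have "J = I / 2" by simp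
  with J show ?thesis by simp
qed

text \<open>Cauchy's formula for the n-th derivative of the generating function on the circle of
  radius \<open>R\<close>. Taking real parts loses nothing because \<open>hermite n x\<close> is
  real, and the symmetry of the integrand folds the circle onto its upper half.\<close>

lemma hermite_integral:
  fixes x R :: real
  assumes R: "R > 0"
  shows "((\<lambda>\<theta>. exp (2 * x * R * cos \<theta> - R ^ 2 * cos (2 * \<theta>))
             * cos (2 * x * R * sin \<theta> - R ^ 2 * sin (2 * \<theta>) - n * \<theta>))
           has_integral (pi * R ^ n / fact n * hermite n x)) {0..pi}" (is "(?f has_integral _) _")
proof -
  define f where "f = (\<lambda>z. exp (2 * complex_of_real x * z - z ^ 2))"
  have "((\<lambda>u. f u / (u - 0) ^ Suc n) has_contour_integral
          (2 * pi * \<i>) / fact n * (deriv ^^ n) f 0) (circlepath 0 R)"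
    unfolding f_def
    by (intro Cauchy_has_contour_integral_higher_derivative_circlepath
        continuous_intros holomorphic_intros) (use R in auto)
  then have "((\<lambda>t. f (R * cis t) / (R * cis t) ^ Suc n * R * \<i> * cis t) has_integral
          (2 * pi * \<i>) / fact n * hermite n x) {0..2 * pi}"
    unfolding circlepath_def
    by (subst (asm) has_contour_integral_part_circlepath_iff)
       (simp_all add: f_def higher_deriv_hermite_generating_function)
  \<comment> \<open>This factor removes the modulus of the n-th power and the \<open>\<i>\<close>
    from dz, leaving the pure phase \<open>cis (- (n * t))\<close>.\<close>
  from has_integral_mult_right[OF this, of "of_real (R ^ n) / \<i>"]
  have "((\<lambda>t. of_real (R ^ n) / \<i> * (f (R * cis t) / (R * cis t) ^ Suc n * R * \<i> * cis t)) has_integral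
          of_real (2 * pi * R ^ n / fact n * hermite n x)) {0..2 * pi}"
    by (simp add: field_simps)
  also have "(\<lambda>t. of_real (R ^ n) / \<i> * (f (R * cis t) / (R * cis t) ^ Suc n * R * \<i> * cis t))
     = (\<lambda>t::real. f (R * cis t) * cis (- (n * t)))"
  proof
    fix t :: real
    have "cis (- (n * t)) = 1 / cis t ^ n"
      by (simp add: Complex.DeMoivre divide_inverse)
    then show "of_real (R ^ n) / \<i> * (f (R * cis t) / (R * cis t) ^ Suc n * R * \<i> * cis t)
        = f (R * cis t) * cis (- (n * t))"
      using R by (simp add: power_mult_distrib field_simps)
  qed
  finally have "((\<lambda>t::real. f (R * cis t) * cis (- (n * t))) has_integral
          of_real (2 * pi * R ^ n / fact n * hermite n x)) {0..2 * pi}" .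
  from has_integral_Re[OF this]
  have "((\<lambda>t::real. Re (f (R * cis t) * cis (- (n * t)))) has_integral
          (2 * pi * R ^ n / fact n * hermite n x)) {0..2 * pi}"
    by (simp only: Re_complex_of_real)
  also have "(\<lambda>t::real. Re (f (R * cis t) * cis (- (n * t)))) = ?f"
  proof
    fix t :: real
    have "2 * of_real x * (R * cis t) - (R * cis t) ^ 2
        = Complex (2 * x * R * cos t - R ^ 2 * cos (2 * t)) (2 * x * R * sin t - R ^ 2 * sin (2 * t))"
      by (simp add: power_mult_distrib Complex.DeMoivre complex_eq_iff Re_power2 Im_power2)
    then have "f (R * cis t) = of_real (exp (2 * x * R * cos t - R ^ 2 * cos (2 * t)))
        * cis (2 * x * R * sin t - R ^ 2 * sin (2 * t))"
      by (simp only: f_def exp_eq_polar complex.sel)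
    then show "Re (f (R * cis t) * cis (- (n * t))) = ?f t"
      by (simp add: mult.assoc cis_mult)
  qed
  finally have int: "(?f has_integral (2 * pi * R ^ n / fact n * hermite n x)) {0..2 * pi}" .
  \<comment> \<open>Under the reflection the phase changes sign up to the multiple
    \<open>2 * n * pi\<close>, which the even, periodic cosine ignores.\<close>
  have "?f (2 * pi - t) = ?f t" for t
  proof -
    have "sin (2 * (2 * pi - t)) = - sin (2 * t)" "cos (2 * (2 * pi - t)) = cos (2 * t)"
      \<comment> \<open>The angle \<open>4 * pi\<close> is written in the shape that
        \<open>cos_2npi\<close> and \<open>sin_2npi\<close> expect.\<close>
      using sin_diff[of "2 * real 2 * pi" "2 * t"] cos_diff[of "2 * real 2 * pi" "2 * t"]
      by (simp_all only: cos_2npi sin_2npi) (simp_all add: algebra_simps)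
    moreover have "cos (- (2 * x * R * sin t) + R\<^sup>2 * sin (2 * t) - real n * (2 * pi - t))
        = cos (2 * x * R * sin t - R\<^sup>2 * sin (2 * t) - real n * t)"
    proof -
      have "- (2 * x * R * sin t) + R\<^sup>2 * sin (2 * t) - real n * (2 * pi - t)
          = - (2 * x * R * sin t - R\<^sup>2 * sin (2 * t) - real n * t) - 2 * real n * pi"
        by (simp add: algebra_simps)
      then show ?thesis
        by (simp only: cos_diff[of _ "2 * real n * pi"] cos_2npi sin_2npi cos_minus mult_1_right mult_zero_right add_0_right)
    qed
    ultimately show ?thesis
      by simp
  qed
  moreover have "2 * pi * R ^ n / fact n * hermite n x / 2 = pi * R ^ n / fact n * hermite n x"
    by simp
  ultimately show ?thesis
    using has_integral_0_2pi_symmetric[where f = ?f, OF int] by (simp only:)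
qed

section \<open>Oscillatory integrals and the Airy function\<close>

text \<open>A first-derivative test: \<open>g * cos \<phi>\<close> is the monotone weight
  \<open>g / \<phi>'\<close> times the derivative of \<open>sin \<phi>\<close>. The second mean
  value theorem splits the integral into two pieces, each at most 2 times the largest weight, whence
  the 4.\<close>

lemma oscillatory_integral_bound:
  fixes g \<phi> \<phi>' :: "real \<Rightarrow> real"
  assumes "a \<le> b"
    and deriv: "\<And>x. a \<le> x \<Longrightarrow> x \<le> b \<Longrightarrow> (\<phi> has_real_derivative \<phi>' x) (at x)"
    and pos: "\<phi>' a > 0"
    and mono: "\<And>x y. a \<le> x \<Longrightarrow> x \<le> y \<Longrightarrow> y \<le> b \<Longrightarrow> \<phi>' x \<le> \<phi>' y"
    and nonneg: "\<And>x. a \<le> x \<Longrightarrow> x \<le> b \<Longrightarrow> g x \<ge> 0"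
    and antimono: "\<And>x y. a \<le> x \<Longrightarrow> x \<le> y \<Longrightarrow> y \<le> b \<Longrightarrow> g y \<le> g x"
  shows "\<bar>integral {a..b} (\<lambda>x. g x * cos (\<phi> x))\<bar> \<le> 4 * g a / \<phi>' a"
proof -
  have pos': "\<phi>' x > 0" if "a \<le> x" "x \<le> b" for x
    using pos mono[of a x] that by linarith
  \<comment> \<open>The minus sign makes the weight nondecreasing, as the mean value theorem is
    applied to a nondecreasing factor.\<close>
  define h where "h x = - (g x / \<phi>' x)" for x
  define p where "p x = \<phi>' x * cos (\<phi> x)" for x
  have p: "(p has_integral sin (\<phi> v) - sin (\<phi> u)) {u..v}" if "a \<le> u" "u \<le> v" "v \<le> b" for u v
  proof (rule fundamental_theorem_of_calculus)
    fix x assume "x \<in> {u..v}"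
    then have "((\<lambda>x. sin (\<phi> x)) has_real_derivative p x) (at x)"
      unfolding p_def using that by (auto intro!: derivative_eq_intros deriv)
    then show "((\<lambda>x. sin (\<phi> x)) has_vector_derivative p x) (at x within {u..v})"
      using has_real_derivative_iff_has_vector_derivative has_vector_derivative_at_within by blast
  qed fact
  have p_bound: "\<bar>integral {u..v} p\<bar> \<le> 2" if "a \<le> u" "u \<le> v" "v \<le> b" for u v
    using integral_unique[OF p[OF that]] abs_sin_le_one[of "\<phi> u"] abs_sin_le_one[of "\<phi> v"]
    by (smt (verit))
  have h_mono: "h x \<le> h y" if "a \<le> x" "x \<le> y" "y \<le> b" for x y
    unfolding h_def using that pos' mono nonneg antimono by (simp add: frac_le)
  obtain c where c: "c \<in> {a..b}"
    and "((\<lambda>x. h x * p x) has_integral (h a * integral {a..c} p + h b * integral {c..b} p)) {a..b}"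
    using second_mean_value_theorem_full[of p a b h] p[of a b] \<open>a \<le> b\<close> h_mono
    by (auto simp: integrable_on_def)
  from has_integral_neg[OF this(2)]
  have "((\<lambda>x. - (h x * p x)) has_integral (- (h a * integral {a..c} p + h b * integral {c..b} p))) {a..b}" .
  also have "?this \<longleftrightarrow> ((\<lambda>x. g x * cos (\<phi> x)) has_integral
      (- (h a * integral {a..c} p + h b * integral {c..b} p))) {a..b}"
  proof (rule has_integral_cong)
    fix x assume "x \<in> {a..b}"
    with pos'[of x] show "- (h x * p x) = g x * cos (\<phi> x)"
      by (simp add: h_def p_def)
  qed
  finally have int: "integral {a..b} (\<lambda>x. g x * cos (\<phi> x))
      = - (h a * integral {a..c} p + h b * integral {c..b} p)"
    by (rule integral_unique)
  have h_bound: "\<bar>h b\<bar> \<le> \<bar>h a\<bar>" "\<bar>h a\<bar> = g a / \<phi>' a"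
    using h_mono[of a b] \<open>a \<le> b\<close> nonneg[of b] pos'[of b] nonneg[of a] pos
    by (auto simp: h_def)
  have "\<bar>h a * integral {a..c} p\<bar> \<le> \<bar>h a\<bar> * 2" "\<bar>h b * integral {c..b} p\<bar> \<le> \<bar>h a\<bar> * 2"
    unfolding abs_mult using p_bound[of a c] p_bound[of c b] c h_bound(1)
    by (auto intro!: mult_mono)
  then show ?thesis
    unfolding int using h_bound(2) by linarith
qed

section \<open>Existence and truncation of the Airy integral\<close>

text \<open>Absolute integrability is not assumed. The criterion \<open>has_integral_alt'\<close>
  tests only intervals containing a large ball around 0, and on these the integral runs from 0 to
  the right endpoint, where the limit applies.\<close>

lemma has_integral_atLeast_limit:
  fixes f :: "real \<Rightarrow> real"
  assumes cont: "continuous_on {0..} f"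
    and lim: "((\<lambda>T. integral {0..T} f) \<longlongrightarrow> l) at_top"
  shows "(f has_integral l) {0..}"
  unfolding has_integral_alt'
proof (intro conjI allI impI)
  fix a b :: real
  have "f integrable_on {max 0 a..b}"
    by (intro integrable_continuous_real continuous_on_subset[OF cont]) auto
  then have "(\<lambda>x. if x \<in> {max 0 a..b} then f x else 0) integrable_on cbox a b"
    by (subst integrable_restrict_Int) (simp add: Int_absorb2)
  then show "(\<lambda>x. if x \<in> {0..} then f x else 0) integrable_on cbox a b"
    by (rule integrable_eq) auto
next
  fix e :: real assume "e > 0"
  then obtain B where B: "\<And>T. T \<ge> B \<Longrightarrow> \<bar>integral {0..T} f - l\<bar> < e"
    using lim by (auto simp: tendsto_iff eventually_at_top_linorder dist_real_def)
  show "\<exists>B>0. \<forall>a b. ball 0 B \<subseteq> cbox a b \<longrightarrow>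
      norm (integral (cbox a b) (\<lambda>x. if x \<in> {0..} then f x else 0) - l) < e"
  proof (intro exI[of _ "max B 1"] conjI allI impI)
    fix a b :: real assume "ball 0 (max B 1) \<subseteq> cbox a b"
    then have ab: "a \<le> - max B 1" "max B 1 \<le> b"
      by (auto simp: ball_eq_greaterThanLessThan greaterThanLessThan_subseteq_atLeastAtMost_iff)
    have "integral (cbox a b) (\<lambda>x. if x \<in> {0..} then f x else 0) = integral ({0..} \<inter> cbox a b) f"
      by (rule integral_restrict_Int)
    also have "{0..} \<inter> cbox a b = {0..b}" using ab by auto
    finally show "norm (integral (cbox a b) (\<lambda>x. if x \<in> {0..} then f x else 0) - l) < e"
      using B[of b] ab by simp
  qed simp
qed

text \<open>The oscillatory bound with constant modulus 1: the condition on \<open>x\<close> keeps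
  the phase derivative \<open>s ^ 2 + x\<close> at least \<open>S ^ 2 / 2\<close>.\<close>

lemma airy_tail_bound:
  fixes x S T :: real
  assumes "S \<ge> 1" "S \<le> T" "2 * \<bar>x\<bar> \<le> S ^ 2"
  shows "\<bar>integral {S..T} (\<lambda>s. cos (s ^ 3 / 3 + x * s))\<bar> \<le> 8 / S ^ 2"
proof -
  have pos: "S ^ 2 > 0" "S ^ 2 + x \<ge> S ^ 2 / 2" using assms by auto
  then have pos': "S ^ 2 + x > 0" by linarith
  have "\<bar>integral {S..T} (\<lambda>s. 1 * cos (s ^ 3 / 3 + x * s))\<bar> \<le> 4 * 1 / (S ^ 2 + x)"
  proof (rule oscillatory_integral_bound)
    fix s :: real
    show "((\<lambda>s. s ^ 3 / 3 + x * s) has_real_derivative s ^ 2 + x) (at s)"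
      by (auto intro!: derivative_eq_intros)
  qed (use assms pos' in \<open>auto intro!: power_mono simp del: zero_less_power2\<close>)
  also have "\<dots> \<le> 4 / (S ^ 2 / 2)"
    using pos pos' by (intro frac_le) auto
  finally show ?thesis by simp
qed

text \<open>The tail bound makes the truncated integrals Cauchy, so the integral defining
  \<open>Ai x\<close> exists; the same bound survives the limit. It depends on \<open>x\<close> only
  through the condition on \<open>S\<close>, hence is uniform on bounded sets.\<close>

lemma Ai_truncation_bound:
  fixes x S :: real
  assumes S: "S \<ge> 1" "2 * \<bar>x\<bar> \<le> S ^ 2"
  shows "\<bar>integral {0..S} (\<lambda>s. cos (s ^ 3 / 3 + x * s)) - pi * Ai x\<bar> \<le> 8 / S ^ 2"
proof -
  define f where "f s = cos (s ^ 3 / 3 + x * s)" for s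
  define I where "I T = integral {0..T} f" for T
  have int: "f integrable_on {a..b}" for a b
    unfolding f_def by (intro integrable_continuous_real continuous_intros) auto
  have diff: "\<bar>I T - I U\<bar> \<le> 8 / U ^ 2" if "S \<le> U" "U \<le> T" for U T
  proof -
    have "2 * \<bar>x\<bar> \<le> U ^ 2"
      using S that power_mono[of S U 2] by linarith
    then have "\<bar>integral {U..T} f\<bar> \<le> 8 / U ^ 2"
      unfolding f_def using S that by (intro airy_tail_bound) auto
    moreover have "I U + integral {U..T} f = I T"
      unfolding I_def using S that by (intro Henstock_Kurzweil_Integration.integral_combine int) auto
    ultimately show ?thesis by linarith
  qed
  have "cauchy_filter (filtermap I at_top)"
    unfolding cauchy_filter_metric_filtermap
  proof (intro allI impI)
    fix e :: real assume "e > 0"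
    then have "\<forall>\<^sub>F U :: real in at_top. 8 / U ^ 2 < e" by real_asymp
    then obtain V where V: "\<And>U. U \<ge> V \<Longrightarrow> 8 / U ^ 2 < e"
      by (auto simp: eventually_at_top_linorder)
    have "dist (I T) (I U) < e" if "T \<ge> max S V" "U \<ge> max S V" for T U
      using diff[of T U] diff[of U T] V[of T] V[of U] that unfolding dist_real_def
      by linarith
    then show "\<exists>P. eventually P at_top \<and> (\<forall>T U. P T \<and> P U \<longrightarrow> dist (I T) (I U) < e)"
      by (intro exI[of _ "\<lambda>T. T \<ge> max S V"] conjI eventually_ge_at_top) auto
  qed
  then have "\<exists>l. filtermap I at_top \<le> nhds l"
    using complete_UNIV[where 'a = real] unfolding complete_uniform
    by (auto simp: filtermap_bot_iff)
  then obtain l where l: "(I \<longlongrightarrow> l) at_top" by (auto simp: filterlim_def)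
  have "(f has_integral l) {0..}"
    using l unfolding I_def by (intro has_integral_atLeast_limit) (auto simp: f_def intro!: continuous_intros)
  then have "Ai x = l / pi"
    by (simp add: Ai_def integral_unique flip: f_def)
  moreover have "\<bar>I S - l\<bar> \<le> 8 / S ^ 2"
  proof (rule tendsto_upperbound)
    show "((\<lambda>T. \<bar>I S - I T\<bar>) \<longlongrightarrow> \<bar>I S - l\<bar>) at_top"
      by (intro tendsto_intros l)
    show "\<forall>\<^sub>F T in at_top. \<bar>I S - I T\<bar> \<le> 8 / S ^ 2"
      using eventually_ge_at_top[of S] by eventually_elim (use diff[of S] in \<open>simp add: abs_minus_commute\<close>)
  qed simp
  ultimately show ?thesis by (simp add: I_def flip: f_def)
qed

section \<open>The rescaled integral near the turning point\<close>

text \<open>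
  For \<open>N ^ 3 = n\<close>, \<open>R\<^sup>2 = n / 2\<close>, \<open>z = R exp (\<i> \<theta>)\<close> and \<open>x\<close> with Airy variable \<open>t\<close>, i.e. \<open>2 R x = 2 n + t N\<close>, one has
  \<open>2 x z - z\<^sup>2 - \<i> n \<theta> = 3 n / 2 + t N + airy_exponent N t \<theta> + \<i> airy_phase N t \<theta>\<close>.
\<close>
definition airy_exponent :: "real \<Rightarrow> real \<Rightarrow> real \<Rightarrow> real" where
  "airy_exponent N t \<theta> = - (N ^ 3 * (1 - cos \<theta>) ^ 2 + t * N * (1 - cos \<theta>))"

definition airy_phase :: "real \<Rightarrow> real \<Rightarrow> real \<Rightarrow> real" where
  "airy_phase N t \<theta> = N ^ 3 * (2 * sin \<theta> - sin (2 * \<theta>) / 2 - \<theta>) + t * N * sin \<theta>"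

definition airy_kernel :: "real \<Rightarrow> real \<Rightarrow> real \<Rightarrow> real" where
  "airy_kernel N t \<theta> = exp (airy_exponent N t \<theta>) * cos (airy_phase N t \<theta>)"

lemma continuous_on_airy_kernel [continuous_intros]: "continuous_on A (airy_kernel N t)"
  unfolding airy_kernel_def airy_exponent_def airy_phase_def by (intro continuous_intros) auto

lemma airy_kernel_integrable: "airy_kernel N t integrable_on {a..b}"
  by (intro integrable_continuous_real continuous_intros)

section \<open>Elementary bounds for sine, cosine and the exponential\<close>

lemma one_minus_cos_le: "1 - cos \<theta> \<le> \<theta> ^ 2 / 2" for \<theta> :: real
proof -
  have "\<bar>sin (\<theta> / 2)\<bar> ^ 2 \<le> \<bar>\<theta> / 2\<bar> ^ 2"
    by (intro power_mono abs_sin_x_le_abs_x) auto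
  moreover have "cos \<theta> = 1 - 2 * sin (\<theta> / 2) ^ 2"
    using cos_double_sin[of "\<theta> / 2"] by simp
  ultimately show ?thesis by (simp add: power_divide)
qed

lemma sin_cubic_bound: "\<bar>sin x - (x - x ^ 3 / 6)\<bar> \<le> x ^ 4 / 24" for x :: real
proof -
  have "(\<Sum>m<4. sin_coeff m * x ^ m) = x - x ^ 3 / 6"
    by (simp add: lessThan_nat_numeral lessThan_Suc sin_coeff_def fact_numeral)
  then show ?thesis
    using Maclaurin_sin_bound[of x 4] by (simp add: fact_numeral)
qed

lemma sin_linear_bound: "\<bar>sin x - x\<bar> \<le> \<bar>x\<bar> ^ 3 / 6" for x :: real
proof -
  have "(\<Sum>m<3. sin_coeff m * x ^ m) = x"
    by (simp add: lessThan_nat_numeral lessThan_Suc sin_coeff_def)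
  then show ?thesis
    using Maclaurin_sin_bound[of x 3] by (simp add: fact_numeral)
qed

lemma one_minus_cos_ge:
  fixes \<theta> :: real
  assumes "0 \<le> \<theta>" "\<theta> \<le> 1"
  shows "1 - cos \<theta> \<ge> \<theta> ^ 2 / 4"
proof -
  have "\<theta> ^ 3 \<le> \<theta> ^ 1"
    using assms by (intro power_decreasing) auto
  then have "(\<theta> / 2) ^ 3 \<le> \<theta> / 2 * (1/4)"
    by (simp add: power_divide)
  moreover have "\<bar>sin (\<theta> / 2) - \<theta> / 2\<bar> \<le> (\<theta> / 2) ^ 3 / 6"
    using sin_linear_bound[of "\<theta> / 2"] assms by simp
  \<comment> \<open>The cubic error is at most 1/24 of \<open>\<theta> / 2\<close>. The cruder
    factor 3/4 suffices, since squaring and doubling gives 9/32, above 1/4.\<close>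
  ultimately have "sin (\<theta> / 2) \<ge> \<theta> / 2 * (3/4)"
    using assms by linarith
  then have "sin (\<theta> / 2) ^ 2 \<ge> (\<theta> / 2 * (3/4)) ^ 2"
    using assms by (intro power_mono) auto
  moreover have "cos \<theta> = 1 - 2 * sin (\<theta> / 2) ^ 2"
    using cos_double_sin[of "\<theta> / 2"] by simp
  moreover have "(\<theta> / 2 * (3/4)) ^ 2 = 9/64 * \<theta> ^ 2" by (simp add: power2_eq_square)
  moreover have "\<theta> ^ 2 \<ge> 0" by simp
  ultimately show ?thesis by linarith
qed

lemma exp_minus_one_bound:
  fixes x :: real
  assumes "\<bar>x\<bar> \<le> 1"
  shows "\<bar>exp x - 1\<bar> \<le> 2 * \<bar>x\<bar>"
proof (cases "x \<ge> 0")
  case True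
  with assms have "x ^ 2 \<le> x" by (simp add: power2_eq_square mult_left_le)
  with True assms exp_bound[of x] exp_ge_add_one_self[of x] show ?thesis by simp
next
  case False
  then have "exp x < 1" by simp
  with False exp_ge_add_one_self[of x] show ?thesis
    unfolding abs_if by (simp; linarith)
qed

lemma abs_cos_diff_le: "\<bar>cos x - cos y\<bar> \<le> \<bar>x - y\<bar>" for x y :: real
proof -
  have "\<bar>cos x - cos y\<bar> = 2 * \<bar>sin ((x + y) / 2)\<bar> * \<bar>sin ((y - x) / 2)\<bar>"
    by (simp add: cos_diff_cos abs_mult)
  also have "\<dots> \<le> 2 * 1 * \<bar>(y - x) / 2\<bar>"
    by (intro mult_mono abs_sin_x_le_abs_x) auto
  finally show ?thesis by simp
qed

section \<open>The kernel on the three ranges of the angle\<close>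

text \<open>At \<open>\<theta> = s / N\<close> the exponent is \<open>O(1 / N)\<close>. In the phase
  the linear terms of \<open>2 * sin \<theta> - sin (2 * \<theta>) / 2 - \<theta>\<close> cancel,
  reflecting the double saddle, and the cubic term yields \<open>s ^ 3 / 3\<close> up to
  \<open>O(1 / N)\<close>.\<close>

lemma airy_kernel_inner_bound:
  fixes N S M t s :: real
  assumes N: "N \<ge> 1" "N \<ge> S ^ 4 + M * S ^ 2"
    and t: "\<bar>t\<bar> \<le> M" and s: "0 \<le> s" "s \<le> S"
  shows "\<bar>airy_kernel N t (s / N) - cos (s ^ 3 / 3 + t * s)\<bar> \<le> (2 * S ^ 4 + M * S ^ 2 + M * S ^ 3) / N"
proof -
  define \<theta> where "\<theta> = s / N"
  define u where "u = 1 - cos \<theta>"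
  have M: "M \<ge> 0" and S: "S \<ge> 0" using t s by auto
  have N3: "N ^ 3 * \<theta> ^ 4 = s ^ 4 / N" "N ^ 3 * \<theta> ^ 3 = s ^ 3" "N * \<theta> ^ 2 = s ^ 2 / N" "N * \<theta> = s"
    "N * \<theta> ^ 3 = s ^ 3 / N ^ 2"
    using N(1) by (auto simp: \<theta>_def power_divide power2_eq_square power3_eq_cube power4_eq_xxxx field_simps)
  have pw: "s ^ 4 \<le> S ^ 4" "s ^ 3 \<le> S ^ 3" "s ^ 2 \<le> S ^ 2"
    using s by (auto intro: power_mono)
  have u: "0 \<le> u" "u \<le> \<theta> ^ 2 / 2" unfolding u_def using one_minus_cos_le[of \<theta>] by simp_all
  have E: "\<bar>airy_exponent N t \<theta>\<bar> \<le> (S ^ 4 + M * S ^ 2) / 2 / N"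
  proof -
    have "N ^ 3 * u ^ 2 \<le> N ^ 3 * (\<theta> ^ 2 / 2) ^ 2"
      using u N(1) by (intro mult_left_mono power_mono) auto
    also have "\<dots> = s ^ 4 / N / 4"
      using N3(1) by (simp add: power_divide flip: power_mult)
    also have "\<dots> \<le> S ^ 4 / 2 / N"
      unfolding divide_divide_eq_left by (rule frac_le) (use pw N(1) S in auto)
    also have "N ^ 3 * u ^ 2 = \<bar>N ^ 3 * u ^ 2\<bar>"
      using N(1) by (intro abs_of_nonneg[symmetric] mult_nonneg_nonneg) auto
    finally have "\<bar>N ^ 3 * u ^ 2\<bar> \<le> S ^ 4 / 2 / N" .
    moreover have "\<bar>t * N * u\<bar> \<le> M * S ^ 2 / 2 / N"
    proof -
      have "\<bar>t * N * u\<bar> = \<bar>t\<bar> * (N * u)" using N(1) u by (simp add: abs_mult)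
      also have "\<dots> \<le> M * (N * (\<theta> ^ 2 / 2))"
        using t u N(1) M by (intro mult_mono mult_left_mono) auto
      also have "\<dots> = M * s ^ 2 / 2 / N" using N3(3) by simp
      also have "\<dots> \<le> M * S ^ 2 / 2 / N"
        using pw M N(1) by (intro divide_right_mono mult_left_mono) auto
      finally show ?thesis .
    qed
    ultimately show ?thesis
      unfolding airy_exponent_def u_def[symmetric] by (simp add: add_divide_distrib)
  qed
  \<comment> \<open>The lower bound on \<open>N\<close> serves to put the exponent in the range of
    \<open>exp_minus_one_bound\<close>.\<close>
  have "(S ^ 4 + M * S ^ 2) / 2 / N \<le> 1"
    using N S M by (simp add: field_simps)
  with E have "\<bar>exp (airy_exponent N t \<theta>) - 1\<bar> \<le> (S ^ 4 + M * S ^ 2) / N"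
    using exp_minus_one_bound[of "airy_exponent N t \<theta>"] by simp
  moreover have "\<bar>airy_phase N t \<theta> - (s ^ 3 / 3 + t * s)\<bar> \<le> (S ^ 4 / 2 + M * S ^ 3 / 6) / N"
  proof -
    \<comment> \<open>The two Taylor errors add up to \<open>(2/24 + 16/48) * \<theta> ^ 4\<close>,
      that is 5/12 of \<open>\<theta> ^ 4\<close>.\<close>
    have "\<bar>2 * sin \<theta> - sin (2 * \<theta>) / 2 - \<theta> - \<theta> ^ 3 / 3\<bar> \<le> \<theta> ^ 4 / 2"
    proof -
      have "\<theta> ^ 4 \<ge> 0" by simp
      with sin_cubic_bound[of \<theta>] sin_cubic_bound[of "2 * \<theta>"] show ?thesis
        unfolding abs_le_iff by (simp add: power_mult_distrib)
    qed
    then have "N ^ 3 * \<bar>2 * sin \<theta> - sin (2 * \<theta>) / 2 - \<theta> - \<theta> ^ 3 / 3\<bar> \<le> N ^ 3 * (\<theta> ^ 4 / 2)"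
      using N(1) by (intro mult_left_mono) auto
    also have "\<dots> \<le> S ^ 4 / 2 / N"
      using N3(1) pw N(1) by (simp add: divide_right_mono mult.commute)
    also have "N ^ 3 * \<bar>2 * sin \<theta> - sin (2 * \<theta>) / 2 - \<theta> - \<theta> ^ 3 / 3\<bar>
        = \<bar>N ^ 3 * (2 * sin \<theta> - sin (2 * \<theta>) / 2 - \<theta>) - s ^ 3 / 3\<bar>"
    proof -
      have "N ^ 3 * (2 * sin \<theta> - sin (2 * \<theta>) / 2 - \<theta>) - s ^ 3 / 3
          = N ^ 3 * (2 * sin \<theta> - sin (2 * \<theta>) / 2 - \<theta> - \<theta> ^ 3 / 3)"
        using N3(2) by (simp add: right_diff_distrib)
      then show ?thesis using N(1) by (simp only: abs_mult) simp
    qed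
    finally have 1: "\<bar>N ^ 3 * (2 * sin \<theta> - sin (2 * \<theta>) / 2 - \<theta>) - s ^ 3 / 3\<bar> \<le> S ^ 4 / 2 / N" .
    have "\<bar>t * N * sin \<theta> - t * s\<bar> = \<bar>t\<bar> * (N * \<bar>sin \<theta> - \<theta>\<bar>)"
    proof -
      have "t * N * sin \<theta> - t * s = t * (N * (sin \<theta> - \<theta>))"
        using N3(4) by (simp add: right_diff_distrib)
      then show ?thesis using N(1) by (simp add: abs_mult)
    qed
    also have "\<dots> \<le> M * (N * (\<theta> ^ 3 / 6))"
      using sin_linear_bound[of \<theta>] t M N(1) s by (intro mult_mono mult_left_mono) (auto simp: \<theta>_def)
    also have "\<dots> = M * s ^ 3 / 6 / N ^ 2"
      using N3(5) by simp
    also have "\<dots> \<le> M * S ^ 3 / 6 / N"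
      using pw N(1) M S s by (intro frac_le mult_mono divide_right_mono) (auto simp: power2_eq_square)
    finally show ?thesis
      using 1 unfolding airy_phase_def add_divide_distrib by linarith
  qed
  then have "\<bar>cos (airy_phase N t \<theta>) - cos (s ^ 3 / 3 + t * s)\<bar> \<le> (S ^ 4 / 2 + M * S ^ 3 / 6) / N"
    using abs_cos_diff_le order_trans by blast
  moreover have "\<bar>airy_kernel N t \<theta> - cos (airy_phase N t \<theta>)\<bar> \<le> \<bar>exp (airy_exponent N t \<theta>) - 1\<bar>"
  proof -
    have "airy_kernel N t \<theta> - cos (airy_phase N t \<theta>)
        = (exp (airy_exponent N t \<theta>) - 1) * cos (airy_phase N t \<theta>)"
      unfolding airy_kernel_def left_diff_distrib by simp
    then show ?thesis by (simp only: abs_mult) (rule mult_left_le; simp)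
  qed
  moreover have "(S ^ 4 + M * S ^ 2) / N + (S ^ 4 / 2 + M * S ^ 3 / 6) / N
      \<le> (2 * S ^ 4 + M * S ^ 2 + M * S ^ 3) / N"
  proof -
    have "S ^ 4 \<ge> 0" "M * S ^ 3 \<ge> 0" using M S by auto
    then show ?thesis
      unfolding add_divide_distrib[symmetric] using N(1) by (intro divide_right_mono) linarith+
  qed
  \<comment> \<open>The triangle inequality is stated for plain variables, so that the conclusion is
    mere instantiation.\<close>
  moreover have "\<bar>k - c\<bar> \<le> Z"
    if "\<bar>e\<bar> \<le> X" "\<bar>p - c\<bar> \<le> Y" "\<bar>k - p\<bar> \<le> \<bar>e\<bar>" "X + Y \<le> Z" for k c e p X Y Z :: real
    using that by linarith
  ultimately show ?thesis
    unfolding \<theta>_def by blast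
qed

text \<open>Here the kernel has no useful absolute bound, but the first-derivative test applies: at
  the left end the phase derivative is at least of order \<open>N * S ^ 2\<close> and the modulus is
  at most 3. The upper limit 1/2 keeps \<open>u\<close> at most 1/8, where the phase derivative is
  still increasing.\<close>

lemma airy_kernel_oscillatory_bound:
  fixes N S M t :: real
  assumes S: "S \<ge> 1" "4 * M \<le> S ^ 2" and N: "N \<ge> 2 * S" "N \<ge> M * S ^ 2"
    and t: "\<bar>t\<bar> \<le> M"
  shows "\<bar>integral {S / N..1/2} (airy_kernel N t)\<bar> \<le> 56 / S ^ 2 / N"
proof -
  define a where "a = S / N"
  define u where "u \<theta> = 1 - cos \<theta>" for \<theta> :: real
  \<comment> \<open>The exponent and the derivative \<open>\<phi>'\<close> of the phase are quadratic polynomials in \<open>u\<close>, which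
    increases with \<open>\<theta>\<close>; hence their monotonicity is that of the polynomials.\<close>
  define \<phi>' where "\<phi>' \<theta> = (1 - u \<theta>) * (2 * N ^ 3 * u \<theta> + t * N)" for \<theta>
  have N_pos: "N > 0" and M: "M \<ge> 0" using S N t by linarith+
  have a: "0 < a" "a \<le> 1/2" using S N N_pos by (auto simp: a_def field_simps)
  have Na: "N ^ 3 * a ^ 2 = N * S ^ 2" "N * a ^ 2 = S ^ 2 / N"
    using N_pos by (auto simp: a_def field_simps power3_eq_cube power2_eq_square)
  have tM: "- M \<le> t" "t \<le> M" using t by auto
  have tN: "t * N \<le> M * N" "- (M * N) \<le> t * N"
    using mult_right_mono[OF tM(1), of N] mult_right_mono[OF tM(2), of N] N_pos by auto
  have u_mono: "u x \<le> u y" if "a \<le> x" "x \<le> y" "y \<le> 1/2" for x y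
    unfolding u_def using that a pi_gt3 by (simp add: cos_mono_le_eq)
  have u_ge: "u x \<ge> a ^ 2 / 4" if "a \<le> x" "x \<le> 1/2" for x
    using u_mono[of a x] one_minus_cos_ge[of a] a that unfolding u_def by linarith
  have u_le: "u x \<le> 1/8" if "a \<le> x" "x \<le> 1/2" for x
    using u_mono[of x "1/2"] one_minus_cos_le[of "1/2"] that
    unfolding u_def by (simp add: power2_eq_square)
  have Nu: "N ^ 3 * u x \<ge> N * S ^ 2 / 4" "N * S ^ 2 / 4 \<ge> M * N" if "a \<le> x" "x \<le> 1/2" for x
  proof -
    have "N ^ 3 * u x \<ge> N ^ 3 * (a ^ 2 / 4)"
      using u_ge[OF that] N_pos by (intro mult_left_mono) auto
    then show "N ^ 3 * u x \<ge> N * S ^ 2 / 4" using Na(1) by simp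
    have "N * (4 * M) \<le> N * S ^ 2" using N_pos S by (intro mult_left_mono) auto
    then show "N * S ^ 2 / 4 \<ge> M * N" by (simp add: mult_ac)
  qed
  have "\<bar>integral {a..1/2} (\<lambda>\<theta>. exp (airy_exponent N t \<theta>) * cos (airy_phase N t \<theta>))\<bar>
      \<le> 4 * exp (airy_exponent N t a) / \<phi>' a"
  proof (rule oscillatory_integral_bound)
    fix x :: real
    have "N ^ 3 * (2 * cos x - cos (2 * x) - 1) + t * N * cos x = \<phi>' x"
      unfolding \<phi>'_def u_def cos_double_cos by (simp add: power2_eq_square algebra_simps)
    then show "(airy_phase N t has_real_derivative \<phi>' x) (at x)"
      unfolding airy_phase_def[abs_def] by (auto intro!: derivative_eq_intros simp: algebra_simps)
  next
    show "\<phi>' a > 0"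
    proof -
      have "2 * N ^ 3 * u a + t * N > 0"
      proof -
        have "N * S ^ 2 / 4 > 0" using N_pos S by simp
        then show ?thesis using Nu[of a] tN a by linarith
      qed
      then show ?thesis
        unfolding \<phi>'_def using u_le[of a] a by (intro mult_pos_pos) auto
    qed
  next
    fix x y assume xy: "a \<le> x" "x \<le> y" "y \<le> 1/2"
    have "N * M \<le> N * (N * N)"
    proof -
      have "N * N \<ge> S * S" using N S by (intro mult_mono) auto
      then have "M \<le> N * N" using S M by (simp add: power2_eq_square)
      then show ?thesis using N_pos by (intro mult_left_mono) auto
    qed
    then have "t * N \<le> N ^ 3" using tN by (simp add: power3_eq_cube mult_ac)
    moreover have "N ^ 3 * (u x + u y) \<le> N ^ 3 * (1/4)"
      using u_le[of x] u_le[of y] xy N_pos by (intro mult_left_mono) auto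
    moreover have "N ^ 3 > 0" using N_pos by simp
    \<comment> \<open>This is the divided difference of \<open>\<phi>'\<close>, viewed as a
      quadratic in \<open>u\<close>; the facts above make it at least
      \<open>N ^ 3 / 2\<close>.\<close>
    ultimately have "2 * N ^ 3 - 2 * (N ^ 3 * (u x + u y)) - t * N \<ge> 0"
      by linarith
    then have "(u y - u x) * (2 * N ^ 3 - 2 * (N ^ 3 * (u x + u y)) - t * N) \<ge> 0"
      using u_mono[OF xy] by (intro mult_nonneg_nonneg) auto
    also have "(u y - u x) * (2 * N ^ 3 - 2 * (N ^ 3 * (u x + u y)) - t * N) = \<phi>' y - \<phi>' x"
      unfolding \<phi>'_def by (simp add: algebra_simps)
    finally show "\<phi>' x \<le> \<phi>' y" by simp
    have "M * N \<ge> 0" using M N_pos by simp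
    \<comment> \<open>The negated divided difference of the exponent in \<open>u\<close>; the
      quadratic part dominates because \<open>N ^ 3 * u x\<close> is at least
      \<open>M * N\<close>.\<close>
    then have "N ^ 3 * u x + N ^ 3 * u y + t * N \<ge> 0"
      using Nu[of x] Nu[of y] xy tN by linarith
    then have "0 \<le> (u y - u x) * (N ^ 3 * u x + N ^ 3 * u y + t * N)"
      using u_mono[OF xy] by (intro mult_nonneg_nonneg) auto
    also have "\<dots> = airy_exponent N t x - airy_exponent N t y"
      unfolding airy_exponent_def u_def[symmetric] by (simp add: algebra_simps power2_eq_square)
    finally show "exp (airy_exponent N t y) \<le> exp (airy_exponent N t x)" by simp
  qed (use a in auto)
  \<comment> \<open>The 3 bounds \<open>exp 1\<close>, and 7/8 bounds \<open>1 - u a\<close> from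
    below. The quotient is 384/7, just under 56, over \<open>N * S ^ 2\<close>.\<close>
  also have "\<dots> \<le> 4 * 3 / (7/8 * (N * S ^ 2 / 4))"
  proof (intro frac_le mult_left_mono)
    have "u a \<le> a ^ 2 / 2" unfolding u_def by (rule one_minus_cos_le)
    have "airy_exponent N t a \<le> - (t * N * u a)"
      unfolding airy_exponent_def u_def[symmetric] using N_pos by simp
    also have "\<dots> = - (t * N) * u a" by simp
    also have "\<dots> \<le> M * N * (a ^ 2 / 2)"
      using tN M N_pos \<open>u a \<le> a ^ 2 / 2\<close> u_ge[of a] a
      by (intro mult_mono) (auto intro: order_trans[OF _ u_ge[of a]])
    also have "\<dots> = M * S ^ 2 / (2 * N)" using Na(2) by (simp add: mult.assoc)
    also have "\<dots> \<le> 1" using N N_pos by (simp add: field_simps)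
    finally have "exp (airy_exponent N t a) \<le> exp 1" by simp
    then show "exp (airy_exponent N t a) \<le> 3" using exp_le by linarith
    have "N * S ^ 2 / 4 \<le> 2 * N ^ 3 * u a + t * N"
      using Nu[of a] tN a by linarith
    then show "7/8 * (N * S ^ 2 / 4) \<le> \<phi>' a"
      unfolding \<phi>'_def using u_le[of a] a N_pos by (intro mult_mono) auto
  qed (use N_pos S in auto)
  also have "\<dots> \<le> 56 / S ^ 2 / N"
    using N_pos S by (simp add: divide_simps)
  finally show ?thesis
    unfolding a_def airy_kernel_def[abs_def] .
qed

text \<open>Away from the saddle the modulus alone suffices: \<open>1 - cos \<theta>\<close> lies
  between 1/16 and 2, which gives the 1/256 and the factor 2, and 4 exceeds the length of the
  interval.\<close>

lemma airy_kernel_far_bound: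
  fixes N M t :: real
  assumes N: "N \<ge> 0" and t: "\<bar>t\<bar> \<le> M"
  shows "\<bar>integral {1/2..pi} (airy_kernel N t)\<bar> \<le> 4 * exp (2 * M * N - N ^ 3 / 256)"
proof -
  have M: "M \<ge> 0" using t by auto
  have "norm (integral (cbox (1/2) pi) (airy_kernel N t))
      \<le> exp (2 * M * N - N ^ 3 / 256) * measure lborel (cbox (1/2) pi)"
  proof (rule has_integral_bound)
    show "(airy_kernel N t has_integral integral (cbox (1/2) pi) (airy_kernel N t)) (cbox (1/2) pi)"
      using airy_kernel_integrable by (simp add: integrable_integral)
    fix \<theta> assume "\<theta> \<in> cbox (1/2) pi"
    then have "cos \<theta> \<le> cos (1/2)"
      by (subst cos_mono_le_eq) auto
    also have "cos (1/2 :: real) \<le> 1 - (1/2) ^ 2 / 4"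
      using one_minus_cos_ge[of "1/2"] by simp
    finally have u: "1 - cos \<theta> \<ge> 1/16" "1 - cos \<theta> \<le> 2" "0 \<le> 1 - cos \<theta>"
      using cos_ge_minus_one[of \<theta>] by (auto simp: power2_eq_square)
    have "N ^ 3 * (1 - cos \<theta>) ^ 2 \<ge> N ^ 3 * (1/16) ^ 2"
      using u N by (intro mult_left_mono power_mono) auto
    moreover have "- (t * N * (1 - cos \<theta>)) \<le> M * N * 2"
    proof -
      have "- t * N * (1 - cos \<theta>) \<le> M * N * 2"
        using u N t M by (intro mult_mono mult_right_mono) (auto simp: abs_le_iff)
      then show ?thesis by simp
    qed
    ultimately have "airy_exponent N t \<theta> \<le> 2 * M * N - N ^ 3 / 256"
      unfolding airy_exponent_def by (simp add: power_divide)
    moreover have "\<bar>airy_kernel N t \<theta>\<bar> \<le> exp (airy_exponent N t \<theta>)"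
      by (simp add: airy_kernel_def abs_mult mult_left_le)
    ultimately show "norm (airy_kernel N t \<theta>) \<le> exp (2 * M * N - N ^ 3 / 256)"
      using order_trans by fastforce
  qed simp
  also have "\<dots> \<le> exp (2 * M * N - N ^ 3 / 256) * 4"
    using pi_less_4 pi_gt3 by (intro mult_left_mono) auto
  finally show ?thesis by (simp add: mult.commute)
qed

text \<open>First \<open>S\<close> is fixed, depending only on \<open>M\<close> and
  \<open>e\<close>, so that both oscillatory tails together, \<open>8 / S ^ 2\<close> for Airy and
  \<open>56 / S ^ 2\<close> for the kernel, stay below \<open>e / 2\<close>; then \<open>N\<close>
  grows. No bound involves \<open>t\<close> beyond \<open>M\<close>, so the limit is
  uniform.\<close>

lemma airy_kernel_integral_limit:
  fixes M e :: real
  assumes "e > 0"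
  shows "\<forall>\<^sub>F N in at_top. \<forall>t. \<bar>t\<bar> \<le> M \<longrightarrow>
    \<bar>N * integral {0..pi} (airy_kernel N t) - pi * Ai t\<bar> < e"
proof -
  have "\<forall>\<^sub>F S in at_top. S \<ge> 1 \<and> 4 * M \<le> S ^ 2 \<and> 64 / S ^ 2 < e / 2"
    using \<open>e > 0\<close> by (intro eventually_conj; real_asymp)
  then obtain S where S: "S \<ge> 1" "4 * M \<le> S ^ 2" "64 / S ^ 2 < e / 2"
    by (auto simp: eventually_at_top_linorder)
  define C where "C = 2 * S ^ 4 + M * S ^ 2 + M * S ^ 3"
  have "\<forall>\<^sub>F N in at_top. N \<ge> 2 * S" "\<forall>\<^sub>F N in at_top. N \<ge> M * S ^ 2"
    "\<forall>\<^sub>F N in at_top. N \<ge> S ^ 4 + M * S ^ 2" "\<forall>\<^sub>F N in at_top. N \<ge> (1 :: real)"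
    by (rule eventually_ge_at_top)+
  moreover have "((\<lambda>N. C / N * S + N * (4 * exp (2 * M * N - N ^ 3 / 256))) \<longlongrightarrow> 0) at_top"
    by real_asymp
  then have "\<forall>\<^sub>F N in at_top. C / N * S + N * (4 * exp (2 * M * N - N ^ 3 / 256)) < e / 2"
    using \<open>e > 0\<close> by (intro order_tendstoD) auto
  ultimately show ?thesis
  proof eventually_elim
    case (elim N)
    show ?case
    proof (intro allI impI)
      fix t assume t: "\<bar>t\<bar> \<le> M"
      define K where "K = airy_kernel N t"
      define f where "f s = cos (s ^ 3 / 3 + t * s)" for s
      have int: "K integrable_on {a..b}" for a b
        unfolding K_def by (rule airy_kernel_integrable)
      have range: "0 \<le> S / N" "S / N \<le> 1/2" "1/2 \<le> pi"
        using elim S pi_gt3 by (auto simp: field_simps)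
      have split: "integral {0..pi} K
          = integral {0..S / N} K + integral {S / N..1/2} K + integral {1/2..pi} K"
        using Henstock_Kurzweil_Integration.integral_combine[of 0 "S / N" pi K]
          Henstock_Kurzweil_Integration.integral_combine[of "S / N" "1/2" pi K] int range by auto
      \<comment> \<open>The substitution \<open>s = N * \<theta>\<close> produces the factor
        \<open>N\<close> in front of the integral.\<close>
      have "((\<lambda>s. K (1 / N * s)) has_integral N * integral {0..S / N} K) {0..S}"
      proof -
        have "(\<lambda>s. s / (1 / N)) ` {0..S / N} = {0..S}"
          using elim S by (subst image_divide_atLeastAtMost) auto
        moreover have "1 / \<bar>1 / N\<bar> = N" using elim by simp
        ultimately show ?thesis
          using has_integral_stretch_real[OF integrable_integral[OF int], of "1 / N" 0 "S / N"] elim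
          by simp
      qed
      moreover have "(f has_integral integral {0..S} f) {0..S}"
        unfolding f_def by (intro integrable_integral integrable_continuous_real continuous_intros) auto
      ultimately have "((\<lambda>s. K (1 / N * s) - f s) has_integral
          (N * integral {0..S / N} K - integral {0..S} f)) {0..S}"
        by (rule has_integral_diff)
      then have "norm (N * integral {0..S / N} K - integral {0..S} f) \<le> C / N * measure lborel (cbox 0 S)"
      proof (intro has_integral_bound)
        show "0 \<le> C / N"
          using t S elim by (auto simp: C_def intro!: divide_nonneg_nonneg add_nonneg_nonneg mult_nonneg_nonneg)
        fix s assume "s \<in> cbox 0 S"
        then show "norm (K (1 / N * s) - f s) \<le> C / N"
          using airy_kernel_inner_bound[of N S M t s] elim t by (simp add: K_def f_def C_def)
      qed auto
      then have "\<bar>N * integral {0..S / N} K - integral {0..S} f\<bar> \<le> C / N * S"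
        using S by simp
      moreover have "\<bar>integral {0..S} f - pi * Ai t\<bar> \<le> 8 / S ^ 2"
        unfolding f_def using S t by (intro Ai_truncation_bound) auto
      moreover have "N * \<bar>integral {S / N..1/2} K\<bar> \<le> N * (56 / S ^ 2 / N)"
        unfolding K_def using S t elim
        by (intro mult_left_mono airy_kernel_oscillatory_bound) auto
      then have "\<bar>N * integral {S / N..1/2} K\<bar> \<le> 56 / S ^ 2"
        using elim by (simp add: abs_mult)
      moreover have "N * \<bar>integral {1/2..pi} K\<bar> \<le> N * (4 * exp (2 * M * N - N ^ 3 / 256))"
        unfolding K_def using t elim by (intro mult_left_mono airy_kernel_far_bound) auto
      then have "\<bar>N * integral {1/2..pi} K\<bar> \<le> N * (4 * exp (2 * M * N - N ^ 3 / 256))"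
        using elim by (simp add: abs_mult)
      moreover have "8 / S ^ 2 + 56 / S ^ 2 = 64 / S ^ 2" by simp
      ultimately show "\<bar>N * integral {0..pi} K - pi * Ai t\<bar> < e" 
        unfolding split distrib_left using S(3) elim by linarith
    qed
  qed
qed

section \<open>Turning-point asymptotics\<close>

text \<open>An exact identity that isolates the factors having limits: the Stirling quotient and the
  rescaled kernel integral. Everything else in the prefactor is the amplitude.\<close>

lemma hermite_eq_airy_kernel_integral:
  fixes n :: nat and \<xi> :: real
  defines "N \<equiv> real n powr (1/3)" and "t \<equiv> real n powr (1/6) * sqrt 2 * (\<xi> - sqrt (2 * real n))"
  assumes n: "n > 0"
  shows "hermite n \<xi> = amplitude n \<xi> *
    (fact n / (sqrt (2 * pi * n) * (n / exp 1) ^ n) * (N * integral {0..pi} (airy_kernel N t) / pi))"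
proof -
  \<comment> \<open>The saddle points of \<open>2 * x * z - z ^ 2 - n * ln z\<close> coalesce at
    this radius when \<open>x = sqrt (2 * n)\<close>.\<close>
  define R where "R = sqrt (real n / 2)"
  define A where "A = exp (3/2 * real n + t * N)"
  have R: "R > 0" "R ^ 2 = real n / 2"
    using n by (simp_all add: R_def)
  have "(2 * R) ^ 2 = 2 * real n"
    using R(2) by (simp add: power_mult_distrib)
  then have R2: "2 * R = sqrt (2 * real n)"
    by (rule real_sqrt_unique[symmetric]) (use R(1) in simp)
  then have R3: "R * sqrt (2 * real n) = n"
    using R(2) by (simp add: power2_eq_square flip: R2)
  have N3: "N ^ 3 = real n"
    using n by (simp add: N_def powr_power)
  have N: "N > 0" "real n powr (1/6) * N = sqrt n"
    using n by (auto simp: N_def powr_half_sqrt simp flip: powr_add)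
  have "t * N = (real n powr (1/6) * N) * sqrt 2 * (\<xi> - sqrt (2 * real n))"
    by (simp add: t_def)
  also have "\<dots> = sqrt (2 * real n) * (\<xi> - sqrt (2 * real n))"
    unfolding N(2) by (simp add: real_sqrt_mult)
  also have "\<dots> = \<xi> * sqrt (2 * real n) - sqrt (2 * real n) * sqrt (2 * real n)"
    by (simp only: right_diff_distrib mult.commute)
  finally have tN: "t * N = \<xi> * sqrt (2 * real n) - 2 * real n"
    by simp
  have x: "2 * \<xi> * R = 2 * real n + t * N"
    using R2 tN by (simp add: algebra_simps)
  have "exp (2 * \<xi> * R * cos \<theta> - R ^ 2 * cos (2 * \<theta>))
      * cos (2 * \<xi> * R * sin \<theta> - R ^ 2 * sin (2 * \<theta>) - n * \<theta>) = A * airy_kernel N t \<theta>" for \<theta> :: real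
  proof -
    have "2 * \<xi> * R * cos \<theta> - R ^ 2 * cos (2 * \<theta>) = 3/2 * real n + t * N + airy_exponent N t \<theta>"
      unfolding x R(2) airy_exponent_def N3 cos_double_cos by (simp add: power2_eq_square algebra_simps)
    moreover have "2 * \<xi> * R * sin \<theta> - R ^ 2 * sin (2 * \<theta>) - n * \<theta> = airy_phase N t \<theta>"
      unfolding x R(2) airy_phase_def N3 by (simp add: algebra_simps)
    ultimately show ?thesis
      by (simp add: airy_kernel_def A_def exp_add)
  qed
  with hermite_integral[OF R(1), of \<xi> n]
  have "((\<lambda>\<theta>. A * airy_kernel N t \<theta>) has_integral pi * R ^ n / fact n * hermite n \<xi>) {0..pi}"
    by (simp only:)
  moreover have "((\<lambda>\<theta>. A * airy_kernel N t \<theta>) has_integral A * integral {0..pi} (airy_kernel N t)) {0..pi}"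
    by (intro has_integral_mult_right integrable_integral airy_kernel_integrable)
  ultimately have "pi * R ^ n / fact n * hermite n \<xi> = A * integral {0..pi} (airy_kernel N t)"
    by (rule has_integral_unique)
  then have "hermite n \<xi> = fact n / R ^ n * A * (integral {0..pi} (airy_kernel N t) / pi)"
    using R(1) by (simp add: field_simps)
  also have "fact n / R ^ n * A = amplitude n \<xi> * (fact n / (sqrt (2 * pi * n) * (n / exp 1) ^ n) * N)"
  proof -
    have "exp (real n / 2 * ln (2 * real n)) = sqrt (2 * real n) ^ n"
    proof -
      have "sqrt (2 * real n) = exp (ln (2 * real n) / 2)"
        using n by (simp add: powr_def flip: powr_half_sqrt)
      then show ?thesis by (simp flip: exp_of_nat_mult)
    qed
    moreover have "exp (- (3/2) * real n + \<xi> * sqrt (2 * real n)) = A * inverse (exp 1 ^ n)"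
      by (simp add: A_def tN flip: exp_of_nat_mult exp_minus exp_add)
    moreover have "exp (real n / 2 * ln (2 * real n) - 3/2 * real n + \<xi> * sqrt (2 * real n))
        = exp (real n / 2 * ln (2 * real n)) * exp (- (3/2) * real n + \<xi> * sqrt (2 * real n))"
      by (simp flip: exp_add)
    ultimately have "exp (real n / 2 * ln (2 * real n) - 3/2 * real n + \<xi> * sqrt (2 * real n))
        = sqrt (2 * real n) ^ n * (A * inverse (exp 1 ^ n))"
      by (simp only:)
    then have "amplitude n \<xi> * N = sqrt (2 * pi) * (real n powr (1/6) * N)
        * (sqrt (2 * real n) ^ n * (A * inverse (exp 1 ^ n)))"
      by (simp add: amplitude_def)
    also have "\<dots> = sqrt (2 * pi * n) * (n / exp 1) ^ n * (A / R ^ n)"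
    proof -
      \<comment> \<open>Since \<open>R * sqrt (2 * n) = n\<close>, the power of the radius supplies
        the \<open>n ^ n\<close> of Stirling's formula.\<close>
      have root: "sqrt (2 * real n) ^ n = real n ^ n / R ^ n"
        using R(1) R3 by (simp add: field_simps flip: power_mult_distrib)
      show ?thesis
        unfolding N(2) root real_sqrt_mult[of "2 * pi" "real n"] power_divide
        by (simp only: divide_inverse mult_ac)
    qed
    finally have "amplitude n \<xi> * N = sqrt (2 * pi * n) * (n / exp 1) ^ n * (A / R ^ n)" .
    moreover have "sqrt (2 * pi * n) * (n / exp 1) ^ n \<noteq> 0" using n by simp
    moreover have "c / R ^ n * A = a * (c / d * N)" if "a * N = d * (A / R ^ n)" "d \<noteq> 0" for a c d
    proof -
      have "a * (c / d * N) = c / d * (a * N)" by simp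
      then show ?thesis unfolding that(1) using that(2) by simp
    qed
    ultimately show ?thesis by blast
  qed
  finally show ?thesis by (simp add: mult_ac)
qed

text \<open>Truncation at a point depending only on \<open>M\<close> leaves an integral of at most
  the interval length and a tail of at most 8. Boundedness is needed where the Stirling error
  multiplies the Airy value.\<close>

lemma Ai_bounded: "\<exists>B. \<forall>t. \<bar>t\<bar> \<le> M \<longrightarrow> \<bar>Ai t\<bar> \<le> B"
proof (intro exI allI impI)
  fix t :: real assume t: "\<bar>t\<bar> \<le> M"
  \<comment> \<open>With \<open>S\<close> at least 1, \<open>S ^ 2\<close> is at least
    \<open>S\<close> and hence at least \<open>2 * \<bar>t\<bar>\<close>.\<close>
  define S where "S = max 1 (2 * M)"
  define I where "I = integral {0..S} (\<lambda>s. cos (s ^ 3 / 3 + t * s))"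
  have S: "S \<ge> 1" "2 * \<bar>t\<bar> \<le> S ^ 2"
  proof -
    show "S \<ge> 1" by (simp add: S_def)
    then have "S * 1 \<le> S ^ 2" unfolding power2_eq_square by (intro mult_left_mono) auto
    with t show "2 * \<bar>t\<bar> \<le> S ^ 2" by (simp add: S_def)
  qed
  have "norm I \<le> 1 * measure lborel (cbox 0 S)"
  proof (rule has_integral_bound)
    show "((\<lambda>s. cos (s ^ 3 / 3 + t * s)) has_integral I) (cbox 0 S)"
      unfolding I_def box_real
      by (intro integrable_integral integrable_continuous_real continuous_intros) auto
  qed auto
  then have "\<bar>I\<bar> \<le> S" using S by simp
  moreover have "\<bar>I - pi * Ai t\<bar> \<le> 8 / S ^ 2"
    unfolding I_def using S by (rule Ai_truncation_bound)
  moreover have "8 / S ^ 2 \<le> 8"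
    using S(1) by (simp add: divide_le_eq)
  ultimately have "\<bar>pi * Ai t\<bar> \<le> S + 8" by linarith
  moreover have "1 * \<bar>Ai t\<bar> \<le> pi * \<bar>Ai t\<bar>"
    using pi_gt3 by (intro mult_right_mono) auto
  ultimately show "\<bar>Ai t\<bar> \<le> max 1 (2 * M) + 8"
    by (simp add: abs_mult S_def)
qed

lemma Lambda4_eq_amplitude:
  "Lambda4 n \<xi> = amplitude n \<xi> * Ai (real n powr (1/6) * sqrt 2 * (\<xi> - sqrt (2 * real n)))"
  by (simp add: Lambda4_def amplitude_def)

lemma Lambda3_minus: "Lambda3 n (- \<xi>) = (-1) ^ n * Lambda4 n \<xi>"
  by (simp add: Lambda3_def Lambda4_def algebra_simps)

text \<open>Divided by the amplitude, the error is \<open>\<rho> * J - Ai t\<close>, split as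
  \<open>\<rho> * (J - Ai t) + (\<rho> - 1) * Ai t\<close>. The layer condition bounds the Airy
  variable, so the uniform kernel limit handles the first term, and Stirling with boundedness of
  \<open>Ai\<close> the second.\<close>

lemma hermite_Lambda4_smallo:
  assumes "in_layer \<xi> (\<lambda>n. sqrt (2 * real n))"
  shows "(\<lambda>n. hermite n (\<xi> n) - Lambda4 n (\<xi> n)) \<in> o(\<lambda>n. amplitude n (\<xi> n))"
proof -
  define t where "t n = real n powr (1/6) * sqrt 2 * (\<xi> n - sqrt (2 * real n))" for n
  define N where "N n = real n powr (1/3)" for n :: nat
  define \<rho> where "\<rho> n = fact n / (sqrt (2 * pi * n) * (n / exp 1) ^ n)" for n :: nat
  define J where "J n = N n * integral {0..pi} (airy_kernel (N n) (t n)) / pi" for n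
  obtain M where M: "\<forall>\<^sub>F n in sequentially. \<bar>t n\<bar> \<le> M"
  proof -
    obtain c where "\<forall>\<^sub>F n in sequentially. \<bar>\<xi> n - sqrt (2 * real n)\<bar> \<le> c * \<bar>real n powr (-1/6)\<bar>"
      using assms unfolding in_layer_def by (auto elim!: landau_o.bigE)
    then have "\<forall>\<^sub>F n in sequentially. \<bar>t n\<bar> \<le> sqrt 2 * c"
      using eventually_gt_at_top[of 0]
    proof eventually_elim
      case (elim n)
      have "\<bar>t n\<bar> = real n powr (1/6) * sqrt 2 * \<bar>\<xi> n - sqrt (2 * real n)\<bar>"
        by (simp add: t_def abs_mult)
      also have "\<dots> \<le> real n powr (1/6) * sqrt 2 * (c * real n powr (-1/6))"
        using elim by (intro mult_left_mono) auto
      also have "\<dots> = sqrt 2 * c"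
        using elim by (simp add: powr_minus field_simps)
      finally show ?case .
    qed
    then show ?thesis by (rule that)
  qed
  obtain B where B: "\<And>s. \<bar>s\<bar> \<le> M \<Longrightarrow> \<bar>Ai s\<bar> \<le> B"
    using Ai_bounded[of M] by blast
  have \<rho>: "\<rho> \<longlonglongrightarrow> 1" unfolding \<rho>_def by (rule stirling)
  have amp: "\<forall>\<^sub>F n in sequentially. amplitude n (\<xi> n) \<noteq> 0"
    using eventually_gt_at_top[of 0] by eventually_elim (simp add: amplitude_def)
  have "(\<lambda>n. J n - Ai (t n)) \<longlonglongrightarrow> 0"
  proof (rule tendstoI)
    fix e :: real assume "e > 0"
    have "filterlim N at_top sequentially"
      unfolding N_def by real_asymp
    then have "\<forall>\<^sub>F n in sequentially. \<forall>t. \<bar>t\<bar> \<le> M \<longrightarrow>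
        \<bar>N n * integral {0..pi} (airy_kernel (N n) t) - pi * Ai t\<bar> < e * pi"
      using \<open>e > 0\<close> by (intro eventually_compose_filterlim[OF airy_kernel_integral_limit]) auto
    with M show "\<forall>\<^sub>F n in sequentially. dist (J n - Ai (t n)) 0 < e"
    proof eventually_elim
      case (elim n)
      have "J n - Ai (t n) = (N n * integral {0..pi} (airy_kernel (N n) (t n)) - pi * Ai (t n)) / pi"
        by (simp add: J_def field_simps)
      with elim show ?case by (simp add: divide_less_eq)
    qed
  qed
  with \<rho> have "(\<lambda>n. \<rho> n * (J n - Ai (t n))) \<longlonglongrightarrow> 1 * 0"
    by (rule tendsto_mult)
  moreover have "(\<lambda>n. (\<rho> n - 1) * Ai (t n)) \<longlonglongrightarrow> 0"
  proof (rule Lim_null_comparison)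
    show "\<forall>\<^sub>F n in sequentially. norm ((\<rho> n - 1) * Ai (t n)) \<le> \<bar>\<rho> n - 1\<bar> * B"
      using M by eventually_elim (auto simp: abs_mult intro!: mult_left_mono B)
    have "(\<lambda>n. \<bar>\<rho> n - 1\<bar> * B) \<longlonglongrightarrow> \<bar>1 - 1\<bar> * B"
      by (intro tendsto_intros \<rho>)
    then show "(\<lambda>n. \<bar>\<rho> n - 1\<bar> * B) \<longlonglongrightarrow> 0" by simp
  qed
  ultimately have "(\<lambda>n. \<rho> n * (J n - Ai (t n)) + (\<rho> n - 1) * Ai (t n)) \<longlonglongrightarrow> 0"
    using tendsto_add by fastforce
  moreover have "\<forall>\<^sub>F n in sequentially. \<rho> n * (J n - Ai (t n)) + (\<rho> n - 1) * Ai (t n)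
      = (hermite n (\<xi> n) - Lambda4 n (\<xi> n)) / amplitude n (\<xi> n)"
    using amp eventually_gt_at_top[of 0]
  proof eventually_elim
    case (elim n)
    have "hermite n (\<xi> n) = amplitude n (\<xi> n) * (\<rho> n * J n)"
      unfolding \<rho>_def J_def N_def t_def using elim(2) by (rule hermite_eq_airy_kernel_integral)
    then have "hermite n (\<xi> n) - Lambda4 n (\<xi> n)
        = amplitude n (\<xi> n) * (\<rho> n * (J n - Ai (t n)) + (\<rho> n - 1) * Ai (t n))"
      unfolding Lambda4_eq_amplitude t_def by (simp add: algebra_simps)
    with elim show ?case by simp
  qed
  ultimately have "(\<lambda>n. (hermite n (\<xi> n) - Lambda4 n (\<xi> n)) / amplitude n (\<xi> n)) \<longlonglongrightarrow> 0"
    by (rule Lim_transform_eventually)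
  then show ?thesis using amp by (rule smalloI_tendsto)
qed

text \<open>Where the Airy factor is at least \<open>\<delta>\<close> in modulus, the amplitude is
  \<open>O(Lambda4)\<close> with constant \<open>1 / \<delta>\<close>, so an error small against the
  amplitude is small against \<open>Lambda4\<close> itself.\<close>

lemma hermite_Lambda4_asymp_equiv:
  assumes "in_layer \<xi> (\<lambda>n. sqrt (2 * real n))"
    and "away_from_zero (\<lambda>n. Ai (real n powr (1/6) * sqrt 2 * (\<xi> n - sqrt (2 * real n))))"
  shows "(\<lambda>n. hermite n (\<xi> n)) \<sim>[sequentially] (\<lambda>n. Lambda4 n (\<xi> n))"
proof -
  obtain \<delta> where \<delta>: "\<delta> > 0"
    "\<forall>\<^sub>F n in sequentially. \<delta> \<le> \<bar>Ai (real n powr (1/6) * sqrt 2 * (\<xi> n - sqrt (2 * real n)))\<bar>"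
    using assms(2) unfolding away_from_zero_def by blast
  have "(\<lambda>n. amplitude n (\<xi> n)) \<in> O(\<lambda>n. Lambda4 n (\<xi> n))"
  proof (rule landau_o.bigI[of "1 / \<delta>"])
    show "\<forall>\<^sub>F n in sequentially. norm (amplitude n (\<xi> n)) \<le> 1 / \<delta> * norm (Lambda4 n (\<xi> n))"
      using \<delta>(2)
    proof eventually_elim
      case (elim n)
      then have "\<bar>amplitude n (\<xi> n)\<bar> * \<delta> \<le> \<bar>Lambda4 n (\<xi> n)\<bar>"
        unfolding Lambda4_eq_amplitude abs_mult by (intro mult_left_mono) auto
      with \<delta>(1) show ?case by (simp add: field_simps)
    qed
  qed (use \<delta> in simp)
  with hermite_Lambda4_smallo[OF assms(1)] show ?thesis
    unfolding asymp_equiv_altdef by (rule landau_o.small_big_trans)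
qed

theorem mainTheorem2:
  "(\<forall>\<xi> :: nat \<Rightarrow> real. in_layer \<xi> (\<lambda>n. - sqrt (2 * real n)) \<longrightarrow>
      (\<lambda>n. hermite n (\<xi> n) - Lambda3 n (\<xi> n)) \<in> o(\<lambda>n. amplitude n (- \<xi> n)) \<and>
      (away_from_zero (\<lambda>n. Ai (- (real n powr (1/6) * sqrt 2 * (\<xi> n + sqrt (2 * real n))))) \<longrightarrow>
        (\<lambda>n. hermite n (\<xi> n)) \<sim>[sequentially] (\<lambda>n. Lambda3 n (\<xi> n)))) \<and>
   (\<forall>\<xi> :: nat \<Rightarrow> real. in_layer \<xi> (\<lambda>n. sqrt (2 * real n)) \<longrightarrow>
      (\<lambda>n. hermite n (\<xi> n) - Lambda4 n (\<xi> n)) \<in> o(\<lambda>n. amplitude n (\<xi> n)) \<and>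
      (away_from_zero (\<lambda>n. Ai (real n powr (1/6) * sqrt 2 * (\<xi> n - sqrt (2 * real n)))) \<longrightarrow>
        (\<lambda>n. hermite n (\<xi> n)) \<sim>[sequentially] (\<lambda>n. Lambda4 n (\<xi> n)))) \<and>
   (\<forall>n (\<xi> :: real). Lambda3 n (- \<xi>) = (-1) ^ n * Lambda4 n \<xi>)"
proof (intro conjI allI impI)
  fix \<xi> :: "nat \<Rightarrow> real"
  assume "in_layer \<xi> (\<lambda>n. - sqrt (2 * real n))"
  moreover have "(\<lambda>n. - \<xi> n - sqrt (2 * real n)) = (\<lambda>n. - (\<xi> n - - sqrt (2 * real n)))"
    by simp
  \<comment> \<open>The reflected sequence lies in the layer at the right turning point, so the left
    case follows from the right one by the two parity identities.\<close>
  ultimately have layer: "in_layer (\<lambda>n. - \<xi> n) (\<lambda>n. sqrt (2 * real n))"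
    unfolding in_layer_def by (simp only: landau_o.big.uminus_in_iff)
  have herm: "hermite n (\<xi> n) = (-1) ^ n * hermite n (- \<xi> n)"
    and Lam: "Lambda3 n (\<xi> n) = (-1) ^ n * Lambda4 n (- \<xi> n)" for n
    using hermite_minus[of n "- \<xi> n"] Lambda3_minus[of n "- \<xi> n"] by simp_all
  have "(\<lambda>n. (-1) ^ n * (hermite n (- \<xi> n) - Lambda4 n (- \<xi> n))) \<in> o(\<lambda>n. amplitude n (- \<xi> n))"
  proof -
    \<comment> \<open>Passing to absolute values discards the alternating sign.\<close>
    have "(\<lambda>n. \<bar>(-1) ^ n * (hermite n (- \<xi> n) - Lambda4 n (- \<xi> n))\<bar>)
        \<in> o(\<lambda>n. amplitude n (- \<xi> n))"
      using hermite_Lambda4_smallo[OF layer] by (simp add: abs_mult power_abs)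
    then show ?thesis
      by (simp only: landau_o.small.abs_in_iff)
  qed
  then show "(\<lambda>n. hermite n (\<xi> n) - Lambda3 n (\<xi> n)) \<in> o(\<lambda>n. amplitude n (- \<xi> n))"
    unfolding herm Lam by (simp only: right_diff_distrib)
  assume "away_from_zero (\<lambda>n. Ai (- (real n powr (1/6) * sqrt 2 * (\<xi> n + sqrt (2 * real n)))))"
  then have "away_from_zero (\<lambda>n. Ai (real n powr (1/6) * sqrt 2 * (- \<xi> n - sqrt (2 * real n))))"
    by (simp add: algebra_simps)
  with layer have "(\<lambda>n. hermite n (- \<xi> n)) \<sim>[sequentially] (\<lambda>n. Lambda4 n (- \<xi> n))"
    by (rule hermite_Lambda4_asymp_equiv)
  then show "(\<lambda>n. hermite n (\<xi> n)) \<sim>[sequentially] (\<lambda>n. Lambda3 n (\<xi> n))"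
    unfolding herm Lam by (intro asymp_equiv_intros)
qed (use hermite_Lambda4_smallo hermite_Lambda4_asymp_equiv Lambda3_minus in auto)

end
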